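(* Let $M>0$, $\Lambda>0$ and $Q\neq 0$ be real numbers, and let $f(r)=1-\frac{2M}{r}+\frac{Q^2}{r^2}-\Lambda r^2$ for $r>0$. Then $f$ has exactly three distinct positive zeros if and only if $$Q\neq 0 \quad\text{and}\quad 0<\Lambda<\frac{1}{12Q^2}\quad\text{and}\quad M_1<M<M_2,$$ where $R=\frac{1}{\sqrt{6\Lambda}}$, $\Delta=1-12Q^2\Lambda$, $m_1=R\sqrt{1-\sqrt{\Delta}}$, $m_2=R\sqrt{1+\sqrt{\Delta}}$, $M_1=m_1-2\Lambda m_1^3$, $M_2=m_2-2\Lambda m_2^3$. Moreover, in this case, denoting the three positive zeros of $f$ by $0<r_1<r_2<r_3$, there is exactly one photon sphere of the Reissner-Nordstrøm-de Sitter metric in the static exterior region $\mathbb{R}_t\times\,]r_2,r_3[_r\times \mathcal{S}^2$ of the black hole, i.e. the region between the two largest zeros of $f$.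
   Context: The Reissner-Nordstrøm-de Sitter metric with mass $M$, charge $Q$ and cosmological constant $\Lambda$ is $$g=f(r)\,dt^2-\frac{1}{f(r)}\,dr^2-r^2\left(d\theta^2+\sin^2\theta\, d\varphi^2\right),\qquad f(r)=1-\frac{2M}{r}+\frac{Q^2}{r^2}-\Lambda r^2,$$ on $\mathbb{R}_t\times\,]0,+\infty[_r\times\mathcal{S}^2_{\theta,\varphi}$ (away from the zeros of $f$). Standing assumptions are $M>0$, $\Lambda>0$, $Q\neq0$. The numbers $m_1,m_2,M_1,M_2$ are real when $0<\Lambda<\frac{1}{12Q^2}$ (so that $0<\Delta<1$); the displayed condition is a conjunction, and it is regarded as failing when $\Lambda\ge\frac{1}{12Q^2}$. Photon sphere: a photon sphere in a region where $f>0$ is a hypersurface $\{r=r_0\}$ contained in that region which is filled by null geodesics orbiting at constant $r=r_0$. Precisely, a non-zero purely rotational vector field along the angle $\varphi$, i.e. one of the form $\alpha\,\partial_t+\beta\,\partial_\varphi$, that is null is a multiple of $$\mathcal{V}=\frac{\partial}{\partial t}\pm\frac{\sqrt{f(r)}}{r\sin\theta}\frac{\partial}{\partial\varphi},$$ and $\{r=r_0\}$ is a photon sphere when the integral curves of $\mathcal{V}$ lying in $\{r=r_0,\ \theta=\frac{\pi}{2}\}$ are geodesics of $g$, that is, $\nabla_{\mathcal{V}}\mathcal{V}=0$ there, where $\nabla$ is the Levi-Civita connection of $g$. (By spherical symmetry, the rotated copies of these curves are then also null geodesics, which gives a full sphere of them.) *)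

theory Defs
  imports "HOL-Analysis.Analysis"
begin

text \<open>
  Pseudo-Riemannian metrics in a coordinate chart: \<open>g x $ i $ j\<close> is the component
  \<open>g\<^sub>i\<^sub>j\<close> at the point with coordinates \<open>x\<close>; vector fields are given by
  their components in the coordinate frame.
\<close>

definition partial_deriv :: "'n::finite \<Rightarrow> (real ^ 'n \<Rightarrow> real) \<Rightarrow> real ^ 'n \<Rightarrow> real" where
  "partial_deriv i F x = deriv (\<lambda>h. F (x + h *\<^sub>R axis i 1)) 0"

text \<open>Argument order: \<open>christoffel g k i j x\<close> is \<open>\<Gamma>\<close> with upper index \<open>k\<close>, lower indices \<open>i j\<close>.\<close>

definition christoffel ::
    "(real ^ 'n \<Rightarrow> real ^ 'n ^ 'n) \<Rightarrow> 'n::finite \<Rightarrow> 'n \<Rightarrow> 'n \<Rightarrow> real ^ 'n \<Rightarrow> real" where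
  "christoffel g k i j x =
     (\<Sum>l\<in>UNIV. matrix_inv (g x) $ k $ l *
        (partial_deriv i (\<lambda>y. g y $ j $ l) x
       + partial_deriv j (\<lambda>y. g y $ i $ l) x
       - partial_deriv l (\<lambda>y. g y $ i $ j) x)) / 2"

definition levi_civita ::
    "(real ^ 'n \<Rightarrow> real ^ 'n ^ 'n) \<Rightarrow> (real ^ 'n \<Rightarrow> real ^ 'n) \<Rightarrow> (real ^ 'n \<Rightarrow> real ^ 'n)
      \<Rightarrow> real ^ 'n::finite \<Rightarrow> real ^ 'n" where
  "levi_civita g V W x =
     (\<chi> k. (\<Sum>i\<in>UNIV. V x $ i * partial_deriv i (\<lambda>y. W y $ k) x)
         + (\<Sum>i\<in>UNIV. \<Sum>j\<in>UNIV. christoffel g k i j x * V x $ i * W x $ j))"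

definition rnds_f :: "real \<Rightarrow> real \<Rightarrow> real \<Rightarrow> real \<Rightarrow> real" where
  "rnds_f M Q \<Lambda> r = 1 - 2 * M / r + Q\<^sup>2 / r\<^sup>2 - \<Lambda> * r\<^sup>2"

definition pos_zeros :: "(real \<Rightarrow> real) \<Rightarrow> real set" where
  "pos_zeros f = {r. 0 < r \<and> f r = 0}"

definition rnds_R :: "real \<Rightarrow> real" where
  "rnds_R \<Lambda> = 1 / sqrt (6 * \<Lambda>)"

definition rnds_\<Delta> :: "real \<Rightarrow> real \<Rightarrow> real" where
  "rnds_\<Delta> Q \<Lambda> = 1 - 12 * Q\<^sup>2 * \<Lambda>"

definition rnds_m1 :: "real \<Rightarrow> real \<Rightarrow> real" where
  "rnds_m1 Q \<Lambda> = rnds_R \<Lambda> * sqrt (1 - sqrt (rnds_\<Delta> Q \<Lambda>))"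

definition rnds_m2 :: "real \<Rightarrow> real \<Rightarrow> real" where
  "rnds_m2 Q \<Lambda> = rnds_R \<Lambda> * sqrt (1 + sqrt (rnds_\<Delta> Q \<Lambda>))"

definition rnds_M1 :: "real \<Rightarrow> real \<Rightarrow> real" where
  "rnds_M1 Q \<Lambda> = rnds_m1 Q \<Lambda> - 2 * \<Lambda> * rnds_m1 Q \<Lambda> ^ 3"

definition rnds_M2 :: "real \<Rightarrow> real \<Rightarrow> real" where
  "rnds_M2 Q \<Lambda> = rnds_m2 Q \<Lambda> - 2 * \<Lambda> * rnds_m2 Q \<Lambda> ^ 3"

text \<open>
  The coordinates \<open>(t, r, \<theta>, \<phi>)\<close> are the components \<open>1, 2, 3, 4\<close> of a vector in
  \<open>real ^ 4\<close>.
\<close>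

definition spherical_metric :: "(real \<Rightarrow> real) \<Rightarrow> real ^ 4 \<Rightarrow> real ^ 4 ^ 4" where
  "spherical_metric f x =
     (\<chi> i j. if i \<noteq> j then 0
            else if i = 1 then f (x $ 2)
            else if i = 2 then - (1 / f (x $ 2))
            else if i = 3 then - (x $ 2)\<^sup>2
            else - (x $ 2)\<^sup>2 * (sin (x $ 3))\<^sup>2)"

definition rotational_null_field :: "(real \<Rightarrow> real) \<Rightarrow> real \<Rightarrow> real ^ 4 \<Rightarrow> real ^ 4" where
  "rotational_null_field f s x =
     axis 1 1 + (s * (sqrt (f (x $ 2)) / (x $ 2 * sin (x $ 3)))) *\<^sub>R axis 4 1"

lemma rotational_null_field_null:
  assumes "f (x $ 2) > 0" "x $ 2 > 0" "sin (x $ 3) > 0" "s \<in> {1, -1}"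
  defines "V \<equiv> rotational_null_field f s x"
  shows "V \<bullet> (spherical_metric f x *v V) = 0"
proof -
  have "V $ 1 = 1" "V $ 2 = 0" "V $ 3 = 0"
    and V4: "V $ 4 = s * (sqrt (f (x $ 2)) / (x $ 2 * sin (x $ 3)))"
    by (simp_all add: V_def rotational_null_field_def axis_def)
  then have "V \<bullet> (spherical_metric f x *v V) = f (x $ 2) - (x $ 2 * sin (x $ 3) * V $ 4)\<^sup>2"
    by (simp add: inner_vec_def sum_4 matrix_vector_mult_def spherical_metric_def
        power2_eq_square algebra_simps)
  also have "x $ 2 * sin (x $ 3) * V $ 4 = s * sqrt (f (x $ 2))"
    using assms(2,3) by (simp add: V4)
  also have "f (x $ 2) - (s * sqrt (f (x $ 2)))\<^sup>2 = 0"
    using assms(1,4) by auto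
  finally show ?thesis .
qed

text \<open>
  Points of \<open>\<real>\<^sub>t \<times> ]0,\<infinity>[\<^sub>r \<times> S\<^sup>2\<close> are triples \<open>(t, r, \<omega>)\<close> with \<open>\<omega>\<close> on the unit sphere
  of \<open>real ^ 3\<close>; \<open>spherical_chart\<close> passes from coordinates to points.
\<close>

definition spherical_chart :: "real ^ 4 \<Rightarrow> real \<times> real \<times> (real ^ 3)" where
  "spherical_chart x =
     (x $ 1, x $ 2,
      vector [sin (x $ 3) * cos (x $ 4), sin (x $ 3) * sin (x $ 4), cos (x $ 3)])"

definition static_region :: "real \<Rightarrow> real \<Rightarrow> (real \<times> real \<times> (real ^ 3)) set" where
  "static_region a b = UNIV \<times> {a<..<b} \<times> sphere 0 1"

definition const_r_hypersurface :: "real \<Rightarrow> (real \<times> real \<times> (real ^ 3)) set" where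
  "const_r_hypersurface r0 = UNIV \<times> {r0} \<times> sphere 0 1"

text \<open>
  Both orientations \<open>s = 1\<close>, \<open>s = -1\<close> of the null rotational field are required to be
  geodesic along the equator of the hypersurface; \<open>f r0 > 0\<close> makes the field smooth
  and null there.
\<close>

definition photon_sphere_in ::
    "(real \<Rightarrow> real) \<Rightarrow> (real \<times> real \<times> (real ^ 3)) set \<Rightarrow> (real \<times> real \<times> (real ^ 3)) set \<Rightarrow> bool" where
  "photon_sphere_in f U S \<longleftrightarrow>
     (\<exists>r0. 0 < r0 \<and> 0 < f r0 \<and> S = const_r_hypersurface r0 \<and> S \<subseteq> U \<and>
        (\<forall>s\<in>{1, -1}. \<forall>x. spherical_chart x \<in> S \<and> x $ 3 = pi / 2 \<longrightarrow>
           levi_civita (spherical_metric f)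
             (rotational_null_field f s) (rotational_null_field f s) x = 0))"

end

theory Submission
  imports Defs
begin

text \<open>
  On \<open>r > 0\<close> the zeros of \<open>f\<close> are those of \<open>p r = r\<^sup>2 - 2 M r + Q\<^sup>2 - \<Lambda> r\<^sup>4\<close>. As \<open>p\<close> has no cubic
  term, three distinct zeros \<open>r\<^sub>1, r\<^sub>2, r\<^sub>3\<close> determine the fourth, \<open>- (r\<^sub>1 + r\<^sub>2 + r\<^sub>3)\<close>, hence all the
  coefficients. The numbers \<open>m\<^sub>1 < m\<^sub>2\<close> are the positive roots of \<open>p r - r p' r\<close>, and at such a root
  \<open>p r = 2 r (r - 2 \<Lambda> r\<^sup>3 - M)\<close>; thus \<open>M\<^sub>1 < M < M\<^sub>2\<close> says that \<open>p m\<^sub>1 < 0 < p m\<^sub>2\<close>, and both directions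
  of the criterion follow from the intermediate value theorem. The geodesic equation on \<open>{r = r\<^sub>0}\<close>
  reduces to \<open>r\<^sub>0 f' r\<^sub>0 = 2 f r\<^sub>0\<close>, that is, to \<open>r\<^sub>0\<^sup>2 - 3 M r\<^sub>0 + 2 Q\<^sup>2 = 0\<close>. This quadratic equals
  \<open>2 p r - r p' r / 2\<close>, so it is negative at \<open>r\<^sub>2\<close> and positive at \<open>r\<^sub>3\<close>.
\<close>

section \<open>The horizon quartic\<close>

text \<open>This is \<open>r\<^sup>2 * f r\<close> with the pole cleared: continuous on the whole
  line, with value \<open>Q\<^sup>2\<close> at 0, so that 0 can serve as an endpoint for the
  intermediate value theorem.\<close>

definition rnds_quartic :: "real \<Rightarrow> real \<Rightarrow> real \<Rightarrow> real \<Rightarrow> real" where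
  "rnds_quartic M Q \<Lambda> r = r\<^sup>2 - 2 * M * r + Q\<^sup>2 - \<Lambda> * r ^ 4"

lemma rnds_f_eq_quartic: "r \<noteq> 0 \<Longrightarrow> rnds_f M Q \<Lambda> r = rnds_quartic M Q \<Lambda> r / r\<^sup>2"
  by (simp add: rnds_f_def rnds_quartic_def field_simps power2_eq_square power4_eq_xxxx)

lemma pos_zeros_rnds_f: "pos_zeros (rnds_f M Q \<Lambda>) = {r. 0 < r \<and> rnds_quartic M Q \<Lambda> r = 0}"
  by (auto simp: pos_zeros_def rnds_f_eq_quartic)

lemma continuous_on_rnds_quartic [continuous_intros]: "continuous_on A (rnds_quartic M Q \<Lambda>)"
  unfolding rnds_quartic_def [abs_def] by (intro continuous_intros)

text \<open>Vieta's relations for a quartic with fourth root \<open>- (a + b + c)\<close>, obtained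
  from divided differences: the first ones eliminate \<open>Q\<close>, the second one eliminates
  \<open>M\<close> as well.\<close>

lemma rnds_quartic_coeffs:
  assumes zeros: "rnds_quartic M Q \<Lambda> a = 0" "rnds_quartic M Q \<Lambda> b = 0" "rnds_quartic M Q \<Lambda> c = 0"
    and distinct: "a \<noteq> b" "a \<noteq> c" "b \<noteq> c"
  shows "\<Lambda> * (a\<^sup>2 + b\<^sup>2 + c\<^sup>2 + a * b + a * c + b * c) = 1"
    and "2 * M = \<Lambda> * (a + b) * (a + c) * (b + c)"
    and "Q\<^sup>2 = \<Lambda> * a * b * c * (a + b + c)"
proof -
  note z = zeros [unfolded rnds_quartic_def]
  have divided: "x + y - 2 * M - \<Lambda> * (x + y) * (x\<^sup>2 + y\<^sup>2) = 0"
    if "x\<^sup>2 - 2 * M * x + Q\<^sup>2 - \<Lambda> * x ^ 4 = 0" "y\<^sup>2 - 2 * M * y + Q\<^sup>2 - \<Lambda> * y ^ 4 = 0" "x \<noteq> y" for x y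
  proof -
    have "(x - y) * (x + y - 2 * M - \<Lambda> * (x + y) * (x\<^sup>2 + y\<^sup>2)) = 0"
      using that(1,2) by algebra
    then show ?thesis using that(3) by simp
  qed
  have ab: "a + b - 2 * M - \<Lambda> * (a + b) * (a\<^sup>2 + b\<^sup>2) = 0"
    and ac: "a + c - 2 * M - \<Lambda> * (a + c) * (a\<^sup>2 + c\<^sup>2) = 0"
    using divided z distinct by blast+
  have "(b - c) * (1 - \<Lambda> * (a\<^sup>2 + b\<^sup>2 + c\<^sup>2 + a * b + a * c + b * c)) = 0"
    using ab ac by algebra
  then show 1: "\<Lambda> * (a\<^sup>2 + b\<^sup>2 + c\<^sup>2 + a * b + a * c + b * c) = 1"
    using distinct by simp
  show 2: "2 * M = \<Lambda> * (a + b) * (a + c) * (b + c)"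
    using ab 1 by algebra
  show "Q\<^sup>2 = \<Lambda> * a * b * c * (a + b + c)"
    using z(1) 1 2 by algebra
qed

text \<open>The factor \<open>c - x\<close> absorbs the negative leading coefficient; with
  increasing positive zeros and positive \<Lambda>, every sign can then be read off
  directly.\<close>

lemma rnds_quartic_factor:
  assumes "rnds_quartic M Q \<Lambda> a = 0" "rnds_quartic M Q \<Lambda> b = 0" "rnds_quartic M Q \<Lambda> c = 0"
    and "a \<noteq> b" "a \<noteq> c" "b \<noteq> c"
  shows "rnds_quartic M Q \<Lambda> x = \<Lambda> * (x - a) * (x - b) * (c - x) * (x + (a + b + c))"
proof -
  \<comment> \<open>Even the coefficient 1 of \<open>x\<^sup>2\<close> is replaced by its Vieta
    expression; what remains is a polynomial identity without side conditions.\<close>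
  have "rnds_quartic M Q \<Lambda> x =
      \<Lambda> * (a\<^sup>2 + b\<^sup>2 + c\<^sup>2 + a * b + a * c + b * c) * x\<^sup>2
      - \<Lambda> * (a + b) * (a + c) * (b + c) * x + \<Lambda> * a * b * c * (a + b + c) - \<Lambda> * x ^ 4"
    unfolding rnds_quartic_def rnds_quartic_coeffs(2,3) [OF assms]
    by (simp only: rnds_quartic_coeffs(1) [OF assms] mult_1)
  also have "\<dots> = \<Lambda> * (x - a) * (x - b) * (c - x) * (x + (a + b + c))"
    by algebra
  finally show ?thesis .
qed

section \<open>Critical radii and critical masses\<close>

text \<open>The hypothesis marks the critical points of \<open>p x / x\<close>, in which
  \<open>M\<close> is only an additive constant. Eliminating \<open>Q\<^sup>2\<close> turns the sign
  of \<open>p\<close> there into a comparison of \<open>M\<close> with a critical mass.\<close>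

lemma rnds_critical_value:
  assumes "3 * \<Lambda> * x ^ 4 - x\<^sup>2 + Q\<^sup>2 = 0"
  shows "rnds_quartic M Q \<Lambda> x = 2 * x * (x - 2 * \<Lambda> * x ^ 3 - M)"
  using assms unfolding rnds_quartic_def by algebra

text \<open>The critical equation is quadratic in \<open>x\<^sup>2\<close>, with roots
  \<open>(1 - sqrt \<Delta>) / (6 * \<Lambda>)\<close> and
  \<open>(1 + sqrt \<Delta>) / (6 * \<Lambda>)\<close>.\<close>

lemma rnds_critical_points:
  fixes Q \<Lambda> :: real
  assumes "\<Lambda> > 0" and "Q \<noteq> 0" and \<Delta>: "rnds_\<Delta> Q \<Lambda> > 0"
  shows "0 < rnds_m1 Q \<Lambda>" and "rnds_m1 Q \<Lambda> < rnds_m2 Q \<Lambda>"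
    and "3 * \<Lambda> * rnds_m1 Q \<Lambda> ^ 4 - (rnds_m1 Q \<Lambda>)\<^sup>2 + Q\<^sup>2 = 0"
    and "3 * \<Lambda> * rnds_m2 Q \<Lambda> ^ 4 - (rnds_m2 Q \<Lambda>)\<^sup>2 + Q\<^sup>2 = 0"
proof -
  define d where "d = sqrt (rnds_\<Delta> Q \<Lambda>)"
  have d2: "d\<^sup>2 = 1 - 12 * Q\<^sup>2 * \<Lambda>" and "d > 0"
    using \<Delta> by (simp_all add: d_def rnds_\<Delta>_def)
  \<comment> \<open>A nonzero charge gives \<open>d < 1\<close>, which makes the smaller critical
    radius positive.\<close>
  moreover have "Q\<^sup>2 * \<Lambda> > 0" using assms by simp
  ultimately have "d\<^sup>2 < 1\<^sup>2" by (simp add: mult.commute)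
  then have "d < 1" by (rule power_less_imp_less_base) simp
  have R: "rnds_R \<Lambda> > 0" "(rnds_R \<Lambda>)\<^sup>2 = 1 / (6 * \<Lambda>)"
    using \<open>\<Lambda> > 0\<close> by (simp_all add: rnds_R_def power_divide)
  show "0 < rnds_m1 Q \<Lambda>" "rnds_m1 Q \<Lambda> < rnds_m2 Q \<Lambda>"
    unfolding rnds_m1_def rnds_m2_def d_def [symmetric] using R \<open>d > 0\<close> \<open>d < 1\<close> by simp_all
  \<comment> \<open>The factor \<open>12 * \<Lambda>\<close> completes the square: the product is
    \<open>(6 * \<Lambda> * x\<^sup>2 - 1)\<^sup>2 - d\<^sup>2\<close>.\<close>
  have crit: "3 * \<Lambda> * x ^ 4 - x\<^sup>2 + Q\<^sup>2 = 0" if "6 * \<Lambda> * x\<^sup>2 = 1 + e" "e\<^sup>2 = d\<^sup>2" for x e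
  proof -
    have "12 * \<Lambda> * (3 * \<Lambda> * x ^ 4 - x\<^sup>2 + Q\<^sup>2) = 0"
      using that d2 by algebra
    then show ?thesis using \<open>\<Lambda> > 0\<close> by simp
  qed
  show "3 * \<Lambda> * rnds_m1 Q \<Lambda> ^ 4 - (rnds_m1 Q \<Lambda>)\<^sup>2 + Q\<^sup>2 = 0"
    by (rule crit [of _ "- d"])
      (use R \<open>d < 1\<close> \<open>\<Lambda> > 0\<close> in \<open>simp_all add: rnds_m1_def d_def [symmetric] power_mult_distrib\<close>)
  show "3 * \<Lambda> * rnds_m2 Q \<Lambda> ^ 4 - (rnds_m2 Q \<Lambda>)\<^sup>2 + Q\<^sup>2 = 0"
    by (rule crit [of _ d])
      (use R \<open>d > 0\<close> \<open>\<Lambda> > 0\<close> in \<open>simp_all add: rnds_m2_def d_def [symmetric] power_mult_distrib\<close>)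
qed

lemma rnds_critical_points_unique:
  fixes Q \<Lambda> a b :: real
  assumes "\<Lambda> > 0" and ab: "0 < a" "a < b"
    and a: "3 * \<Lambda> * a ^ 4 - a\<^sup>2 + Q\<^sup>2 = 0" and b: "3 * \<Lambda> * b ^ 4 - b\<^sup>2 + Q\<^sup>2 = 0"
  shows "rnds_\<Delta> Q \<Lambda> > 0" and "a = rnds_m1 Q \<Lambda>" and "b = rnds_m2 Q \<Lambda>"
proof -
  \<comment> \<open>After completing the square, \<open>u\<close> and \<open>v\<close> are both
    square roots of \<Delta>; the order of \<open>a\<close> and \<open>b\<close> forces them to be
    the two opposite ones.\<close>
  define u v where "u = 6 * \<Lambda> * a\<^sup>2 - 1" and "v = 6 * \<Lambda> * b\<^sup>2 - 1"
  have u2: "u\<^sup>2 = rnds_\<Delta> Q \<Lambda>" and v2: "v\<^sup>2 = rnds_\<Delta> Q \<Lambda>"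
    using a b unfolding u_def v_def rnds_\<Delta>_def by algebra+
  have "a\<^sup>2 < b\<^sup>2" using ab by (simp add: power_strict_mono)
  then have "u < v" using \<open>\<Lambda> > 0\<close> by (simp add: u_def v_def)
  moreover have "u\<^sup>2 = v\<^sup>2" using u2 v2 by simp
  ultimately have uv: "u = - v" "v > 0" by (auto simp: power2_eq_iff)
  then have sq: "sqrt (rnds_\<Delta> Q \<Lambda>) = v" using v2 real_sqrt_unique by fastforce
  show "rnds_\<Delta> Q \<Lambda> > 0" using v2 uv by (metis zero_less_power)
  have scale: "x = rnds_R \<Lambda> * sqrt (6 * \<Lambda> * x\<^sup>2)" if "x > 0" for x
    using that \<open>\<Lambda> > 0\<close> by (simp add: rnds_R_def real_sqrt_mult)
  have "6 * \<Lambda> * a\<^sup>2 = 1 - v" "6 * \<Lambda> * b\<^sup>2 = 1 + v" using uv by (simp_all add: u_def v_def)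
  then show "a = rnds_m1 Q \<Lambda>" "b = rnds_m2 Q \<Lambda>"
    using scale [of a] scale [of b] ab by (simp_all add: rnds_m1_def rnds_m2_def sq)
qed

section \<open>The criterion for three horizons\<close>

text \<open>The quartic has signs +, -, +, - at 0, \<open>m\<^sub>1\<close>,
  \<open>m\<^sub>2\<close> and a large \<open>c\<close>, which gives three positive zeros; the
  fourth root is negative.\<close>

lemma three_zeros_if_mass_between:
  fixes M Q \<Lambda> :: real
  assumes "\<Lambda> > 0" "Q \<noteq> 0" "rnds_\<Delta> Q \<Lambda> > 0" "rnds_M1 Q \<Lambda> < M" "M < rnds_M2 Q \<Lambda>"
  shows "card (pos_zeros (rnds_f M Q \<Lambda>)) = 3"
proof -
  let ?p = "rnds_quartic M Q \<Lambda>"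
  define a b where "a = rnds_m1 Q \<Lambda>" and "b = rnds_m2 Q \<Lambda>"
  note crit = rnds_critical_points [OF assms(1-3), folded a_def b_def]
  have pa: "?p a < 0"
    using rnds_critical_value [OF crit(3)] assms(4) crit(1)
    by (simp add: rnds_M1_def a_def mult_pos_neg)
  have pb: "?p b > 0"
    using rnds_critical_value [OF crit(4)] assms(5) crit(1,2)
    by (simp add: rnds_M2_def b_def)
  have p0: "?p 0 > 0" using \<open>Q \<noteq> 0\<close> by (simp add: rnds_quartic_def)
  \<comment> \<open>For \<open>c > 1\<close> the terms of degree at most 2 sum to at most
    \<open>N * c ^ 3\<close>, and \<open>c\<close> is chosen so that
    \<open>\<Lambda> * c > N\<close> lets the quartic term win.\<close>
  define N where "N = 1 + 2 * \<bar>M\<bar> + Q\<^sup>2"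
  define c where "c = 1 + b + N / \<Lambda>"
  have "N > 0" by (simp add: N_def add_pos_nonneg)
  then have c: "c > b" "c > 1" "\<Lambda> * c > N"
    using \<open>\<Lambda> > 0\<close> crit(1,2) by (simp_all add: c_def distrib_left add_pos_pos)
  have "?p c < 0"
  proof -
    have pow: "c\<^sup>2 \<le> c ^ 3" "c \<le> c ^ 3" "1 \<le> c ^ 3"
      using c(2) power_increasing [of 1 3 c] by (simp_all add: power_increasing)
    have "- 2 * M * c \<le> 2 * \<bar>M\<bar> * c"
      using c(2) by (intro mult_right_mono) auto
    then have "c\<^sup>2 - 2 * M * c + Q\<^sup>2 \<le> c\<^sup>2 + 2 * \<bar>M\<bar> * c + Q\<^sup>2 * 1" by simp
    also have "\<dots> \<le> c ^ 3 + 2 * \<bar>M\<bar> * c ^ 3 + Q\<^sup>2 * c ^ 3"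
      using pow by (intro add_mono mult_left_mono) auto
    also have "\<dots> = N * c ^ 3" by (simp add: N_def algebra_simps)
    also have "\<dots> < \<Lambda> * c * c ^ 3"
      using c by (intro mult_strict_right_mono) auto
    finally show ?thesis by (simp add: rnds_quartic_def power4_eq_xxxx power3_eq_cube)
  qed
  note c = c(1) this
  obtain r1 where r1: "0 \<le> r1" "r1 \<le> a" "?p r1 = 0"
    using IVT2' [of ?p a 0 0] pa p0 crit(1) continuous_on_rnds_quartic by auto
  obtain r2 where r2: "a \<le> r2" "r2 \<le> b" "?p r2 = 0"
    using IVT' [of ?p a 0 b] pa pb crit(2) continuous_on_rnds_quartic by auto
  obtain r3 where r3: "b \<le> r3" "r3 \<le> c" "?p r3 = 0"
    using IVT2' [of ?p c 0 b] pb c continuous_on_rnds_quartic by auto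
  have ord: "0 < r1" "r1 < r2" "r2 < r3"
    using r1 r2 r3 pa pb p0 by (force simp: order.order_iff_strict)+
  have "?p x = \<Lambda> * (x - r1) * (x - r2) * (r3 - x) * (x + (r1 + r2 + r3))" for x
    by (rule rnds_quartic_factor) (use r1 r2 r3 ord in auto)
  then have "pos_zeros (rnds_f M Q \<Lambda>) = {r1, r2, r3}"
    using ord \<open>\<Lambda> > 0\<close> by (auto simp: pos_zeros_rnds_f)
  then show ?thesis using ord by simp
qed

text \<open>Alternating slopes at the three zeros place one critical radius in each gap. Uniqueness
  identifies these radii with \<open>m\<^sub>1\<close> and \<open>m\<^sub>2\<close>, and the
  factorisation gives the signs of \<open>p\<close> there.\<close>

lemma mass_between_if_three_zeros:
  fixes M Q \<Lambda> :: real
  assumes "\<Lambda> > 0" and ord: "0 < r1" "r1 < r2" "r2 < r3"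
    and zeros: "rnds_quartic M Q \<Lambda> r1 = 0" "rnds_quartic M Q \<Lambda> r2 = 0" "rnds_quartic M Q \<Lambda> r3 = 0"
  shows "rnds_\<Delta> Q \<Lambda> > 0" and "rnds_M1 Q \<Lambda> < M" and "M < rnds_M2 Q \<Lambda>"
proof -
  let ?p = "rnds_quartic M Q \<Lambda>"
  let ?k = "\<lambda>x. 3 * \<Lambda> * x ^ 4 - x\<^sup>2 + Q\<^sup>2"
  have distinct: "r1 \<noteq> r2" "r1 \<noteq> r3" "r2 \<noteq> r3" using ord by auto
  note coeffs = rnds_quartic_coeffs [OF zeros distinct]
  note factor = rnds_quartic_factor [OF zeros distinct]
  \<comment> \<open>\<open>?k\<close> is \<open>p x - x * p' x\<close>, so at a zero of
    \<open>p\<close> it is \<open>- x * p' x\<close>, and the slope comes from the factored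
    form.\<close>
  have "?k r1 = \<Lambda> * r1 * (r2 - r1) * (r3 - r1) * (2 * r1 + r2 + r3)"
    "?k r2 = - (\<Lambda> * r2 * (r2 - r1) * (r3 - r2) * (r1 + 2 * r2 + r3))"
    "?k r3 = \<Lambda> * r3 * (r3 - r1) * (r3 - r2) * (r1 + r2 + 2 * r3)"
    using coeffs by algebra+
  then have k: "?k r1 > 0" "?k r2 < 0" "?k r3 > 0"
    using ord \<open>\<Lambda> > 0\<close> by simp_all
  have cont: "continuous_on A ?k" for A by (intro continuous_intros)
  obtain a where a: "r1 \<le> a" "a \<le> r2" "?k a = 0"
    using IVT2' [of ?k r2 0 r1] k ord cont by auto
  obtain b where b: "r2 \<le> b" "b \<le> r3" "?k b = 0"
    using IVT' [of ?k r2 0 r3] k ord cont by auto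
  have ab: "r1 < a" "a < r2" "r2 < b" "b < r3"
    using a b k by (force simp: order.order_iff_strict)+
  have m: "rnds_\<Delta> Q \<Lambda> > 0" "a = rnds_m1 Q \<Lambda>" "b = rnds_m2 Q \<Lambda>"
    using rnds_critical_points_unique [of \<Lambda> a b Q] a(3) b(3) ab ord \<open>\<Lambda> > 0\<close> by simp_all
  show "rnds_\<Delta> Q \<Lambda> > 0" by (fact m(1))
  have "?p a < 0"
    using factor [of a] ab ord \<open>\<Lambda> > 0\<close> by (simp add: mult_pos_neg mult_neg_pos)
  then show "rnds_M1 Q \<Lambda> < M"
    using rnds_critical_value [OF a(3)] ab ord m(2) by (simp add: rnds_M1_def mult_less_0_iff)
  have "?p b > 0"
    using factor [of b] ab ord \<open>\<Lambda> > 0\<close> by simp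
  then show "M < rnds_M2 Q \<Lambda>"
    using rnds_critical_value [OF b(3)] ab ord m(3) by (simp add: rnds_M2_def zero_less_mult_iff)
qed

lemma card_3_obtain_ordered:
  fixes A :: "'a::linorder set"
  assumes "card A = 3"
  obtains x y z where "x < y" "y < z" "A = {x, y, z}"
proof -
  obtain a b c where A: "A = {a, b, c}" and "a \<noteq> b" "a \<noteq> c" "b \<noteq> c"
    using assms by (auto simp: card_3_iff)
  then consider "a < b" "b < c" | "a < c" "c < b" | "b < a" "a < c" | "b < c" "c < a"
    | "c < a" "a < b" | "c < b" "b < a" by (metis neqE)
  then show ?thesis using that A by cases (metis insert_commute)+
qed

lemma card_pos_zeros_rnds_f_eq_3_iff:
  fixes M Q \<Lambda> :: real
  assumes "\<Lambda> > 0" and "Q \<noteq> 0"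
  shows "card (pos_zeros (rnds_f M Q \<Lambda>)) = 3 \<longleftrightarrow>
    \<Lambda> < 1 / (12 * Q\<^sup>2) \<and> rnds_M1 Q \<Lambda> < M \<and> M < rnds_M2 Q \<Lambda>"
proof -
  \<comment> \<open>Since \<open>sqrt\<close> is total, the critical masses have values for negative
    \<Delta> too; this conjunct keeps all the roots on positive arguments.\<close>
  have \<Delta>: "\<Lambda> < 1 / (12 * Q\<^sup>2) \<longleftrightarrow> rnds_\<Delta> Q \<Lambda> > 0"
    using \<open>Q \<noteq> 0\<close> by (simp add: rnds_\<Delta>_def field_simps)
  show ?thesis
  proof
    assume "card (pos_zeros (rnds_f M Q \<Lambda>)) = 3"
    then obtain r1 r2 r3 where r: "r1 < r2" "r2 < r3"
      "{r. 0 < r \<and> rnds_quartic M Q \<Lambda> r = 0} = {r1, r2, r3}"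
      unfolding pos_zeros_rnds_f by (rule card_3_obtain_ordered)
    then have "r1 > 0" "rnds_quartic M Q \<Lambda> r1 = 0" "rnds_quartic M Q \<Lambda> r2 = 0"
      "rnds_quartic M Q \<Lambda> r3 = 0" by blast+
    then show "\<Lambda> < 1 / (12 * Q\<^sup>2) \<and> rnds_M1 Q \<Lambda> < M \<and> M < rnds_M2 Q \<Lambda>"
      unfolding \<Delta> using mass_between_if_three_zeros r(1,2) \<open>\<Lambda> > 0\<close> by blast
  qed (use three_zeros_if_mass_between assms \<Delta> in blast)
qed

section \<open>Circular null geodesics of a spherical metric\<close>

text \<open>\<open>matrix_inv\<close> is defined by choice, so its value is found through
  uniqueness: an explicit two-sided inverse cancels against the chosen one.\<close>

lemma matrix_inv_diagonal:
  fixes d :: "'n::finite \<Rightarrow> 'a::field"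
  assumes "\<And>i. d i \<noteq> 0"
  shows "matrix_inv (\<chi> i j. if i \<noteq> j then 0 else d i) = (\<chi> i j. if i \<noteq> j then 0 else inverse (d i))"
    (is "matrix_inv ?A = ?B")
proof -
  have diag: "(\<chi> i j. if i \<noteq> j then 0 else e i) ** (\<chi> i j. if i \<noteq> j then 0 else e' i) = mat 1"
    if "\<And>i. e i * e' i = 1" for e e' :: "'n \<Rightarrow> 'a"
  proof -
    have "(\<Sum>k\<in>UNIV. (if i \<noteq> k then 0 else e i) * (if k \<noteq> j then 0 else e' k))
        = (if i = j then 1 else 0)" for i j
    proof -
      have "(\<Sum>k\<in>UNIV. (if i \<noteq> k then 0 else e i) * (if k \<noteq> j then 0 else e' k))
          = (\<Sum>k\<in>UNIV. if k = i then (if i = j then 1 else 0) else 0)"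
        using that by (intro sum.cong) auto
      then show ?thesis by simp
    qed
    then show ?thesis by (simp add: vec_eq_iff matrix_matrix_mult_def mat_def)
  qed
  have inv: "?A ** ?B = mat 1" "?B ** ?A = mat 1"
    using assms by (simp_all add: diag)
  then have "invertible ?A" by (auto simp: invertible_def)
  then have left: "matrix_inv ?A ** ?A = mat 1"
    unfolding invertible_def matrix_inv_def by (rule someI2_ex) simp
  have "matrix_inv ?A = matrix_inv ?A ** (?A ** ?B)" by (simp only: inv(1) matrix_mul_rid)
  also have "\<dots> = ?B" by (simp only: matrix_mul_assoc left matrix_mul_lid)
  finally show ?thesis .
qed

text \<open>The coordinates \<open>t\<close> and \<open>\<phi>\<close> are cyclic: no metric
  component depends on them.\<close>

lemma partial_deriv_spherical_metric_cyclic: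
  assumes "i = 1 \<or> i = 4"
  shows "partial_deriv i (\<lambda>y. spherical_metric f y $ j $ l) x = 0"
proof -
  have "spherical_metric f (x + h *\<^sub>R axis i 1) = spherical_metric f x" for h
    using assms by (auto simp: spherical_metric_def axis_def vec_eq_iff)
  then show ?thesis by (simp add: partial_deriv_def)
qed

lemma partial_deriv_rotational_null_field_cyclic:
  assumes "i = 1 \<or> i = 4"
  shows "partial_deriv i (\<lambda>y. rotational_null_field f s y $ k) x = 0"
proof -
  have "rotational_null_field f s (x + h *\<^sub>R axis i 1) = rotational_null_field f s x" for h
    using assms by (auto simp: rotational_null_field_def axis_def vec_eq_iff)
  then show ?thesis by (simp add: partial_deriv_def)
qed

text \<open>A field along \<open>t\<close> and \<open>\<phi>\<close> meets only these two diagonal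
  components in its acceleration.\<close>

lemma partial_deriv_spherical_metric_r:
  assumes "(f has_real_derivative f') (at (x $ 2))"
  shows "partial_deriv 2 (\<lambda>y. spherical_metric f y $ 1 $ 1) x = f'"
    and "partial_deriv 2 (\<lambda>y. spherical_metric f y $ 4 $ 4) x = - 2 * x $ 2 * (sin (x $ 3))\<^sup>2"
proof -
  have "((\<lambda>h. f (x $ 2 + h)) has_real_derivative f') (at 0)"
    using assms DERIV_shift [of f f' 0 "x $ 2"] by (simp add: add.commute)
  then show "partial_deriv 2 (\<lambda>y. spherical_metric f y $ 1 $ 1) x = f'"
    by (simp add: partial_deriv_def spherical_metric_def axis_def DERIV_imp_deriv)
  have "((\<lambda>h. - (x $ 2 + h)\<^sup>2 * (sin (x $ 3))\<^sup>2) has_real_derivative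
      - 2 * x $ 2 * (sin (x $ 3))\<^sup>2) (at 0)"
    by (auto intro!: derivative_eq_intros)
  then show "partial_deriv 2 (\<lambda>y. spherical_metric f y $ 4 $ 4) x = - 2 * x $ 2 * (sin (x $ 3))\<^sup>2"
    by (simp add: partial_deriv_def spherical_metric_def axis_def DERIV_imp_deriv)
qed

lemma partial_deriv_spherical_metric_theta:
  shows "partial_deriv 3 (\<lambda>y. spherical_metric f y $ 1 $ 1) x = 0"
    and "partial_deriv 3 (\<lambda>y. spherical_metric f y $ 4 $ 4) x =
      - 2 * (x $ 2)\<^sup>2 * sin (x $ 3) * cos (x $ 3)"
proof -
  show "partial_deriv 3 (\<lambda>y. spherical_metric f y $ 1 $ 1) x = 0"
    by (simp add: partial_deriv_def spherical_metric_def axis_def)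
  have "((\<lambda>h. - (x $ 2)\<^sup>2 * (sin (x $ 3 + h))\<^sup>2) has_real_derivative
      - 2 * (x $ 2)\<^sup>2 * sin (x $ 3) * cos (x $ 3)) (at 0)"
    by (auto intro!: derivative_eq_intros)
  then show "partial_deriv 3 (\<lambda>y. spherical_metric f y $ 4 $ 4) x =
      - 2 * (x $ 2)\<^sup>2 * sin (x $ 3) * cos (x $ 3)"
    by (simp add: partial_deriv_def spherical_metric_def axis_def DERIV_imp_deriv)
qed

lemma partial_deriv_spherical_metric_off_diagonal:
  "i \<noteq> j \<Longrightarrow> partial_deriv k (\<lambda>y. spherical_metric f y $ i $ j) x = 0"
  by (simp add: partial_deriv_def spherical_metric_def)

text \<open>The field points along cyclic directions, so its coefficients do not vary along it and
  only Christoffel terms remain. On the equator the polar one vanishes with the cosine; the radial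
  ones are \<open>f * f' / 2\<close> and \<open>- r * f\<close>, the latter weighted by
  \<open>f / r\<^sup>2\<close>.\<close>

lemma levi_civita_rotational_null_field:
  assumes r: "x $ 2 > 0" and f: "f (x $ 2) > 0" and \<theta>: "x $ 3 = pi / 2" and s: "s\<^sup>2 = 1"
    and f': "(f has_real_derivative f') (at (x $ 2))"
  shows "levi_civita (spherical_metric f) (rotational_null_field f s) (rotational_null_field f s) x
    = axis 2 (f (x $ 2) * (f' / 2 - f (x $ 2) / x $ 2))"
proof -
  let ?V = "rotational_null_field f s"
  \<comment> \<open>On the equator the sine is 1, so the two angular entries coincide.\<close>
  define d :: "4 \<Rightarrow> real" where
    "d i = (if i = 1 then f (x $ 2) else if i = 2 then - (1 / f (x $ 2)) else - (x $ 2)\<^sup>2)" for i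
  have "spherical_metric f x = (\<chi> i j. if i \<noteq> j then 0 else d i)"
    by (simp add: spherical_metric_def d_def vec_eq_iff \<theta>)
  moreover have "d i \<noteq> 0" for i using r f by (simp add: d_def)
  ultimately have inv: "matrix_inv (spherical_metric f x) = (\<chi> i j. if i \<noteq> j then 0 else inverse (d i))"
    by (simp add: matrix_inv_diagonal)
  have V: "?V x $ 1 = 1" "?V x $ 2 = 0" "?V x $ 3 = 0" "?V x $ 4 = s * (sqrt (f (x $ 2)) / x $ 2)"
    by (simp_all add: rotational_null_field_def axis_def \<theta>)
  have V4: "?V x $ 4 * ?V x $ 4 = f (x $ 2) / (x $ 2)\<^sup>2"
    using s f by (simp add: V power2_eq_square [symmetric] power_mult_distrib power_divide)
  \<comment> \<open>For cyclic lower indices two of the three derivatives vanish, and the diagonal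
    inverse leaves only \<open>l = k\<close>.\<close>
  have \<Gamma>: "christoffel (spherical_metric f) k i j x = - (inverse (d k) *
      partial_deriv k (\<lambda>y. spherical_metric f y $ i $ j) x) / 2"
    if "i = 1 \<or> i = 4" "j = 1 \<or> j = 4" for k i j
  proof -
    have "christoffel (spherical_metric f) k i j x =
      (\<Sum>l\<in>UNIV. if l = k then - (inverse (d k) *
        partial_deriv k (\<lambda>y. spherical_metric f y $ i $ j) x) else 0) / 2"
      unfolding christoffel_def inv
      by (intro arg_cong2 [of _ _ _ _ "(/)"] sum.cong refl)
        (use that in \<open>auto simp: partial_deriv_spherical_metric_cyclic\<close>)
    then show ?thesis by simp
  qed
  have lc: "levi_civita (spherical_metric f) ?V ?V x $ k =
      christoffel (spherical_metric f) k 1 1 x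
      + christoffel (spherical_metric f) k 4 4 x * (f (x $ 2) / (x $ 2)\<^sup>2)" for k
    by (simp add: levi_civita_def sum_4 V(1-3) partial_deriv_rotational_null_field_cyclic
        \<Gamma> partial_deriv_spherical_metric_off_diagonal mult.assoc V4)
  have "levi_civita (spherical_metric f) ?V ?V x $ k
      = axis 2 (f (x $ 2) * (f' / 2 - f (x $ 2) / x $ 2)) $ k" for k
    using exhaust_4 [of k] r f
    by (auto simp: lc \<Gamma> d_def axis_def \<theta> partial_deriv_spherical_metric_cyclic
        partial_deriv_spherical_metric_r [OF f'] partial_deriv_spherical_metric_theta
        field_simps power2_eq_square)
  then show ?thesis by (simp add: vec_eq_iff)
qed

text \<open>Where \<open>f\<close> and \<open>r\<close> are positive, the radial acceleration
  vanishes exactly at the critical points of \<open>f r / r\<^sup>2\<close>.\<close>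

lemma photon_sphere_in_static_region_iff:
  assumes f': "\<And>r. r > 0 \<Longrightarrow> (f has_real_derivative f' r) (at r)"
  shows "photon_sphere_in f (static_region a b) S \<longleftrightarrow>
    (\<exists>r. 0 < r \<and> 0 < f r \<and> a < r \<and> r < b \<and> r * f' r = 2 * f r \<and> S = const_r_hypersurface r)"
proof -
  have sub: "const_r_hypersurface r \<subseteq> static_region a b \<longleftrightarrow> a < r \<and> r < b" for r
  proof -
    \<comment> \<open>A product inclusion can be read factor by factor only because the other
      factors are nonempty.\<close>
    have "sphere (0 :: real ^ 3) 1 \<noteq> {}" by simp
    then show ?thesis
      unfolding const_r_hypersurface_def static_region_def by (simp add: times_subset_iff)
  qed
  define geodesic where "geodesic r \<longleftrightarrow>
      (\<forall>s\<in>{1, -1}. \<forall>x. spherical_chart x \<in> const_r_hypersurface r \<and> x $ 3 = pi / 2 \<longrightarrow>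
         levi_civita (spherical_metric f)
           (rotational_null_field f s) (rotational_null_field f s) x = 0)" for r
  have geo: "geodesic r \<longleftrightarrow> r * f' r = 2 * f r" (is "?L \<longleftrightarrow> ?R") if "r > 0" "f r > 0" for r
  proof -
    have lc: "levi_civita (spherical_metric f)
        (rotational_null_field f s) (rotational_null_field f s) x = 0 \<longleftrightarrow> ?R"
      if "s \<in> {1, -1}" "x $ 2 = r" "x $ 3 = pi / 2" for s x
    proof -
      have "levi_civita (spherical_metric f) (rotational_null_field f s) (rotational_null_field f s) x
          = axis 2 (f r * (f' r / 2 - f r / r))"
        using levi_civita_rotational_null_field [of x f s "f' r"] that \<open>r > 0\<close> \<open>f r > 0\<close> f' by auto
      moreover have "f r * (f' r / 2 - f r / r) = 0 \<longleftrightarrow> ?R"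
        using \<open>r > 0\<close> \<open>f r > 0\<close> by (auto simp: field_simps)
      ultimately show ?thesis by (simp)
    qed
    \<comment> \<open>An equatorial point at radius \<open>r\<close>, so that the geodesic condition
      is not vacuous.\<close>
    define x :: "real ^ 4" where "x = axis 2 r + axis 3 (pi / 2)"
    have x: "x $ 2 = r" "x $ 3 = pi / 2" "x $ 4 = 0" by (simp_all add: x_def axis_def)
    then have "spherical_chart x \<in> const_r_hypersurface r"
      by (simp add: spherical_chart_def const_r_hypersurface_def norm_vec_def L2_set_def sum_3)
    then have "?L \<Longrightarrow> ?R" using lc [of 1 x] x(1,2) unfolding geodesic_def by simp
    moreover have "x $ 2 = r" if "spherical_chart x \<in> const_r_hypersurface r" for x
      using that by (simp add: spherical_chart_def const_r_hypersurface_def)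
    then have "?R \<Longrightarrow> ?L" using lc unfolding geodesic_def by blast
    ultimately show ?thesis by blast
  qed
  have "photon_sphere_in f (static_region a b) S \<longleftrightarrow>
      (\<exists>r. 0 < r \<and> 0 < f r \<and> S = const_r_hypersurface r \<and> S \<subseteq> static_region a b \<and> geodesic r)"
    unfolding photon_sphere_in_def geodesic_def by (intro ex_cong1 conj_cong refl) simp
  also have "\<dots> \<longleftrightarrow> (\<exists>r. 0 < r \<and> 0 < f r \<and> a < r \<and> r < b \<and> r * f' r = 2 * f r \<and>
      S = const_r_hypersurface r)"
    using geo sub by (intro ex_cong1) auto
  finally show ?thesis .
qed

section \<open>The photon sphere\<close>

lemma DERIV_rnds_f:
  assumes "r > 0"
  shows "(rnds_f M Q \<Lambda> has_real_derivative 2 * M / r\<^sup>2 - 2 * Q\<^sup>2 / r ^ 3 - 2 * \<Lambda> * r) (at r)"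
  unfolding rnds_f_def [abs_def] using assms
  by (auto intro!: derivative_eq_intros simp: field_simps power2_eq_square power3_eq_cube)

text \<open>The \<Lambda> terms cancel in \<open>r * f' r - 2 * f r\<close>, and clearing the
  denominator leaves a quadratic in \<open>r\<close>.\<close>

lemma rnds_photon_equation:
  assumes "r > 0"
  shows "r * (2 * M / r\<^sup>2 - 2 * Q\<^sup>2 / r ^ 3 - 2 * \<Lambda> * r) = 2 * rnds_f M Q \<Lambda> r \<longleftrightarrow>
    r\<^sup>2 - 3 * M * r + 2 * Q\<^sup>2 = 0"
proof -
  have "r * (2 * M / r\<^sup>2 - 2 * Q\<^sup>2 / r ^ 3 - 2 * \<Lambda> * r) - 2 * rnds_f M Q \<Lambda> r
      = - 2 / r\<^sup>2 * (r\<^sup>2 - 3 * M * r + 2 * Q\<^sup>2)"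
    using assms by (simp add: rnds_f_def divide_simps power2_eq_square power3_eq_cube) algebra
  moreover have "- 2 / r\<^sup>2 \<noteq> 0" using assms by simp
  ultimately show ?thesis
    by (subst eq_iff_diff_eq_0) (simp only: mult_eq_0_iff simp_thms)
qed

lemma rnds_unique_photon_radius:
  fixes M Q \<Lambda> :: real
  assumes "\<Lambda> > 0" and ord: "0 < r1" "r1 < r2" "r2 < r3"
    and zeros: "rnds_quartic M Q \<Lambda> r1 = 0" "rnds_quartic M Q \<Lambda> r2 = 0" "rnds_quartic M Q \<Lambda> r3 = 0"
  shows "\<exists>!r. r2 < r \<and> r < r3 \<and> r\<^sup>2 - 3 * M * r + 2 * Q\<^sup>2 = 0"
proof -
  let ?q = "\<lambda>r. r\<^sup>2 - 3 * M * r + 2 * Q\<^sup>2"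
  have distinct: "r1 \<noteq> r2" "r1 \<noteq> r3" "r2 \<noteq> r3" using ord by auto
  \<comment> \<open>At a zero of \<open>p\<close> the quadratic reduces to
    \<open>- r * p' r / 2\<close>, with the slope again in factored form.\<close>
  have eqs: "?q r2 = - (\<Lambda> * r2 * (r2 - r1) * (r3 - r2) * (r1 + 2 * r2 + r3)) / 2"
    "?q r3 = \<Lambda> * r3 * (r3 - r1) * (r3 - r2) * (r1 + r2 + 2 * r3) / 2"
    using rnds_quartic_coeffs [OF zeros distinct] by algebra+
  have q: "?q r2 < 0" "?q r3 > 0"
    unfolding eqs using ord \<open>\<Lambda> > 0\<close> by simp_all
  have "continuous_on {r2..r3} ?q" by (intro continuous_intros)
  then obtain r where r: "r2 \<le> r" "r \<le> r3" "?q r = 0"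
    using IVT' [of ?q r2 0 r3] q ord by auto
  then have "r2 < r" "r < r3" using q by (force simp: order.order_iff_strict)+
  moreover have "y = r" if y: "r2 < y" "?q y = 0" for y
  proof (rule ccontr)
    assume "y \<noteq> r"
    moreover have "(y - r) * (y + r - 3 * M) = 0" using r(3) y(2) by algebra
    ultimately have "3 * M = y + r" by simp
    \<comment> \<open>Two distinct roots to the right of \<open>r2\<close> would make the monic
      quadratic positive at \<open>r2\<close>.\<close>
    then have "?q r2 = (y - r2) * (r - r2)" using r(3) by algebra
    then show False using q y \<open>r2 < r\<close> by (simp add: mult_less_0_iff)
  qed
  ultimately show ?thesis using r(3) by blast
qed

theorem proposition1:
  fixes M Q \<Lambda> :: real
  assumes "M > 0" and "\<Lambda> > 0" and "Q \<noteq> 0"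
  shows "(card (pos_zeros (rnds_f M Q \<Lambda>)) = 3 \<longleftrightarrow>
            Q \<noteq> 0 \<and> (0 < \<Lambda> \<and> \<Lambda> < 1 / (12 * Q\<^sup>2)) \<and>
            (rnds_M1 Q \<Lambda> < M \<and> M < rnds_M2 Q \<Lambda>)) \<and>
         (\<forall>r1 r2 r3. 0 < r1 \<and> r1 < r2 \<and> r2 < r3 \<and>
            pos_zeros (rnds_f M Q \<Lambda>) = {r1, r2, r3} \<longrightarrow>
            (\<exists>!S. photon_sphere_in (rnds_f M Q \<Lambda>) (static_region r2 r3) S))"
proof (intro conjI allI impI)
  show "card (pos_zeros (rnds_f M Q \<Lambda>)) = 3 \<longleftrightarrow>
            Q \<noteq> 0 \<and> (0 < \<Lambda> \<and> \<Lambda> < 1 / (12 * Q\<^sup>2)) \<and>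
            (rnds_M1 Q \<Lambda> < M \<and> M < rnds_M2 Q \<Lambda>)"
    using card_pos_zeros_rnds_f_eq_3_iff assms by blast
next
  fix r1 r2 r3
  assume "0 < r1 \<and> r1 < r2 \<and> r2 < r3 \<and> pos_zeros (rnds_f M Q \<Lambda>) = {r1, r2, r3}"
  then have ord: "0 < r1" "r1 < r2" "r2 < r3"
    and Z: "{r. 0 < r \<and> rnds_quartic M Q \<Lambda> r = 0} = {r1, r2, r3}"
    by (simp_all add: pos_zeros_rnds_f)
  then have zeros: "rnds_quartic M Q \<Lambda> r1 = 0" "rnds_quartic M Q \<Lambda> r2 = 0" "rnds_quartic M Q \<Lambda> r3 = 0"
    by blast+
  have distinct: "r1 \<noteq> r2" "r1 \<noteq> r3" "r2 \<noteq> r3" using ord by auto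
  \<comment> \<open>All factors of the quartic are positive between the two largest zeros, so
    \<open>f\<close> is positive on the whole exterior region.\<close>
  have pos: "0 < rnds_f M Q \<Lambda> r" if "r2 < r" "r < r3" for r
    using that ord \<open>\<Lambda> > 0\<close> rnds_quartic_factor [OF zeros distinct, of r]
    by (simp add: rnds_f_eq_quartic)
  have iff: "photon_sphere_in (rnds_f M Q \<Lambda>) (static_region r2 r3) S \<longleftrightarrow>
      (\<exists>r. 0 < r \<and> 0 < rnds_f M Q \<Lambda> r \<and> r2 < r \<and> r < r3 \<and>
        r * (2 * M / r\<^sup>2 - 2 * Q\<^sup>2 / r ^ 3 - 2 * \<Lambda> * r) = 2 * rnds_f M Q \<Lambda> r \<and>
        S = const_r_hypersurface r)" for S
    by (rule photon_sphere_in_static_region_iff) (rule DERIV_rnds_f)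
  have iff': "photon_sphere_in (rnds_f M Q \<Lambda>) (static_region r2 r3) S \<longleftrightarrow>
      (\<exists>r. (r2 < r \<and> r < r3 \<and> r\<^sup>2 - 3 * M * r + 2 * Q\<^sup>2 = 0) \<and> S = const_r_hypersurface r)" for S
  proof (unfold iff, rule ex_cong1, cases)
    fix r assume "r2 < r \<and> r < r3"
    moreover from this have "0 < r" using ord by simp
    ultimately show "(0 < r \<and> 0 < rnds_f M Q \<Lambda> r \<and> r2 < r \<and> r < r3 \<and>
        r * (2 * M / r\<^sup>2 - 2 * Q\<^sup>2 / r ^ 3 - 2 * \<Lambda> * r) = 2 * rnds_f M Q \<Lambda> r \<and>
        S = const_r_hypersurface r) \<longleftrightarrow>
      (r2 < r \<and> r < r3 \<and> r\<^sup>2 - 3 * M * r + 2 * Q\<^sup>2 = 0) \<and> S = const_r_hypersurface r"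
      using pos rnds_photon_equation by blast
  qed blast
  \<comment> \<open>With a single admissible radius \<open>r\<close>, the hypersurface at
    \<open>r\<close> is the only candidate for \<open>S\<close>.\<close>
  obtain r where "r2 < y \<and> y < r3 \<and> y\<^sup>2 - 3 * M * y + 2 * Q\<^sup>2 = 0 \<longleftrightarrow> y = r" for y
    using rnds_unique_photon_radius [OF \<open>\<Lambda> > 0\<close> ord zeros] by (auto elim!: ex1E)
  then show "\<exists>!S. photon_sphere_in (rnds_f M Q \<Lambda>) (static_region r2 r3) S"
    by (simp add: iff')
qed

end
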